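(* Let $A$ be a relative non-zero sum Heffter array $\mathrm{NH}_t(m,n;h,k)$ that is simple with respect to the orderings $\omega_r$ (for the rows) and $\omega_c$ (for the columns). Then: (1) there exists a cyclic $h$-path decomposition $\mathcal{D}_{\omega_r}$ of $K_{\frac{2mh+t}{t}\times t}$; (2) there exists a cyclic $k$-path decomposition $\mathcal{D}_{\omega_c}$ of $K_{\frac{2nk+t}{t}\times t}$; (3) the decompositions $\mathcal{D}_{\omega_r}$ and $\mathcal{D}_{\omega_c}$ are orthogonal.
   Context: A partially filled (p.f.) array is a matrix in which some cells may be empty. Let $m\ge k\ge 1$, $n\ge h\ge 1$ with $mh=nk$, let $t\ge1$ divide $2nk$, put $v=2nk+t=2mh+t$, and let $J$ be the subgroup of $\mathbb{Z}_v$ of order $t$. An $\mathrm{NH}_t(m,n;h,k)$ is an $m\times n$ p.f. array $A$ with elements in $\mathbb{Z}_v$ such that: (a) each row contains exactly $h$ filled cells and each column exactly $k$ filled cells; (b) the multiset $\{\pm x\mid x\in A\}$ contains each element of $\mathbb{Z}_v\setminus J$ exactly once and no element of $J$; (c) the sum of the elements in every row and in every column is different from $0$ in $\mathbb{Z}_v$. For a finite subset $T$ of an abelian group, an ordering $(t_1,\dots,t_\ell)$ of the elements of $T$ is simple if no proper nonempty subsequence of consecutive terms sums to $0$. When the total sum is non-zero, this is equivalent to $0,s_1,\dots,s_\ell$ being pairwise distinct, where $s_i=\sum_{j=1}^i t_j$. That $A$ is simple with respect to $\omega_r$ and $\omega_c$ means that $\omega_r$ consists of a simple ordering $\omega_{R_i}$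 of the entries of each row $R_i$ of $A$, and $\omega_c$ consists of a simple ordering $\omega_{C_j}$ of the entries of each column $C_j$ of $A$. The decomposition associated with such a family of orderings is the set of all translates by elements of $\mathbb{Z}_v$ of the paths $[0,s_1,s_2,\dots,s_\ell]$, one for each row (for $\mathcal{D}_{\omega_r}$) or each column (for $\mathcal{D}_{\omega_c}$), the $s_i$ being the partial sums of the chosen ordering of that row or column. $K_{q\times r}$ is the complete multipartite graph with $q$ parts each of size $r$. An $\ell$-path decomposition of a graph $K$ is a set of subgraphs of $K$ (blocks), each a path with $\ell$ edges on $\ell+1$ distinct vertices, whose edge-sets partition $E(K)$. It is cyclic if, up to isomorphism, $V(K)=\mathbb{Z}_v$ with $v=|V(K)|$ and for every block $B$ and every $g\in\mathbb{Z}_v$ the translate $B+g$ is also a block (here the parts of the multipartite graph are the cosets of $J$ in $\mathbb{Z}_v$). Two decompositions $\mathcal{D},\mathcal{D}'$ of the same simple graph are orthogonal if every block of $\mathcal{D}$ shares at most one edge with every block of $\mathcal{D}'$. *)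

theory Defs
  imports "HOL-Algebra.Algebra" "HOL-Library.Multiset" "HOL-Library.Sublist"
    "HOL-Library.Disjoint_Sets"
begin

text \<open>Abelian groups are HOL-Algebra groups and hence written multiplicatively; the cyclic group
  \<open>\<int>\<^sub>v\<close> is \<^const>\<open>integer_mod_group\<close>, with carrier \<open>{0..<int v}\<close> and addition modulo \<open>v\<close>.\<close>


section \<open>Relative non-zero sum Heffter arrays\<close>

definition subgroup_of_order :: "nat \<Rightarrow> nat \<Rightarrow> int set" where
  "subgroup_of_order v t = (THE J. subgroup J (integer_mod_group v) \<and> card J = t)"

lemma subgroup_of_order_multiples:
  assumes "v > 0" "t dvd v"
  defines "M \<equiv> {x \<in> carrier (integer_mod_group v). int (v div t) dvd x}"
  shows "subgroup M (integer_mod_group v)" and "card M = t"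
proof -
  let ?d = "v div t"
  from assms(1,2) have t: "t > 0" and vt: "v = ?d * t" and d: "?d > 0"
    by (auto elim!: dvdE)
  have dv: "int ?d dvd int v" using vt by (metis dvd_triv_left of_nat_dvd_iff)
  interpret group "integer_mod_group v" by simp
  show "subgroup M (integer_mod_group v)"
  proof
    show "M \<subseteq> carrier (integer_mod_group v)" by (auto simp: M_def)
    show "\<one>\<^bsub>integer_mod_group v\<^esub> \<in> M" by (simp add: M_def)
    fix x y assume x: "x \<in> M" and y: "y \<in> M"
    have "x \<otimes>\<^bsub>integer_mod_group v\<^esub> y \<in> carrier (integer_mod_group v)"
      using x y by (intro m_closed) (auto simp: M_def)
    then show "x \<otimes>\<^bsub>integer_mod_group v\<^esub> y \<in> M"
      using x y dv by (auto simp: M_def dvd_mod_iff)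
    have "inv\<^bsub>integer_mod_group v\<^esub> x \<in> carrier (integer_mod_group v)"
      using x by (intro inv_closed) (auto simp: M_def)
    then show "inv\<^bsub>integer_mod_group v\<^esub> x \<in> M"
      using x dv by (auto simp: M_def dvd_mod_iff)
  qed
  have "M = (\<lambda>i. int ?d * int i) ` {..<t}"
  proof (intro equalityI subsetI)
    fix x assume "x \<in> M"
    then obtain c where c: "x = int ?d * c" and x: "0 \<le> x" "x < int v"
      using assms(1) by (auto simp: M_def carrier_integer_mod_group elim!: dvdE)
    have "0 \<le> c" using c x(1) d by (simp add: zero_le_mult_iff)
    moreover have "int ?d * c < int ?d * int t"
      using c x(2) vt by (metis of_nat_mult)
    then have "c < int t" using d by (simp add: mult_less_cancel_left)
    ultimately show "x \<in> (\<lambda>i. int ?d * int i) ` {..<t}"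
      using c by (intro image_eqI[of _ _ "nat c"]) auto
  next
    fix x assume "x \<in> (\<lambda>i. int ?d * int i) ` {..<t}"
    then obtain i where i: "x = int ?d * int i" "i < t" by auto
    have "?d * i < ?d * t" using i d by simp
    then have "int ?d * int i < int v" using vt by (metis of_nat_less_iff of_nat_mult)
    then show "x \<in> M" using i assms(1) by (auto simp: M_def carrier_integer_mod_group)
  qed
  moreover have "inj_on (\<lambda>i. int ?d * int i) {..<t}" using d by (auto simp: inj_on_def)
  ultimately show "card M = t" by (simp add: card_image)
qed

lemma subgroup_of_order_eq:
  assumes "v > 0" "t dvd v"
  shows "subgroup_of_order v t = {x \<in> carrier (integer_mod_group v). int (v div t) dvd x}"
    (is "_ = ?M")
  unfolding subgroup_of_order_def
proof (rule the_equality)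
  show "subgroup ?M (integer_mod_group v) \<and> card ?M = t"
    using subgroup_of_order_multiples[OF assms] by simp
next
  fix J assume J: "subgroup J (integer_mod_group v) \<and> card J = t"
  let ?H = "integer_mod_group v\<lparr>carrier := J\<rparr>"
  from assms have t: "t > 0" and vt: "v = v div t * t" by (auto elim!: dvdE)
  interpret group "integer_mod_group v" by simp
  have H: "group ?H" using J by (simp add: subgroup.subgroup_is_group)
  have "J \<subseteq> ?M"
  proof
    fix x assume x: "x \<in> J"
    then have "x [^]\<^bsub>?H\<^esub> order ?H = \<one>\<^bsub>?H\<^esub>"
      using group.pow_order_eq_1[OF H] by simp
    then have "x [^]\<^bsub>integer_mod_group v\<^esub> t = \<one>\<^bsub>integer_mod_group v\<^esub>"
      using J by (simp add: order_def nat_pow_consistent[symmetric])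
    then have "int v dvd int t * x" by (simp add: mod_eq_0_iff_dvd)
    then have "int (v div t) * int t dvd x * int t"
      using vt by (metis mult.commute of_nat_mult)
    then have "int (v div t) dvd x" using t by simp
    then show "x \<in> ?M" using x J subgroup.subset by blast
  qed
  moreover have "finite ?M" "card J = card ?M"
    using J t subgroup_of_order_multiples[OF assms] by (auto intro: card_ge_0_finite)
  ultimately show "J = ?M" by (simp add: card_subset_eq)
qed

text \<open>An \<open>m \<times> n\<close> partially filled array is a function \<open>A\<close> with \<open>A i j = None\<close> for an empty cell;
  its values at \<open>i \<ge> m\<close> or \<open>j \<ge> n\<close> are irrelevant.\<close>

type_synonym 'a pf_array = "nat \<Rightarrow> nat \<Rightarrow> 'a option"

definition filled_cells :: "nat \<Rightarrow> nat \<Rightarrow> 'a pf_array \<Rightarrow> (nat \<times> nat) set" where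
  "filled_cells m n A = {(i, j). i < m \<and> j < n \<and> A i j \<noteq> None}"

definition filled_in_row :: "nat \<Rightarrow> 'a pf_array \<Rightarrow> nat \<Rightarrow> nat set" where
  "filled_in_row n A i = {j. j < n \<and> A i j \<noteq> None}"

definition filled_in_col :: "nat \<Rightarrow> 'a pf_array \<Rightarrow> nat \<Rightarrow> nat set" where
  "filled_in_col m A j = {i. i < m \<and> A i j \<noteq> None}"

definition row_entries :: "nat \<Rightarrow> 'a pf_array \<Rightarrow> nat \<Rightarrow> 'a set" where
  "row_entries n A i = (\<lambda>j. the (A i j)) ` filled_in_row n A i"

definition col_entries :: "nat \<Rightarrow> 'a pf_array \<Rightarrow> nat \<Rightarrow> 'a set" where
  "col_entries m A j = (\<lambda>i. the (A i j)) ` filled_in_col m A j"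

definition plus_minus_entries ::
    "('a, 'b) monoid_scheme \<Rightarrow> nat \<Rightarrow> nat \<Rightarrow> 'a pf_array \<Rightarrow> 'a multiset" where
  "plus_minus_entries G m n A =
     (\<Sum>(i, j) \<in> filled_cells m n A. {# the (A i j), inv\<^bsub>G\<^esub> (the (A i j)) #})"

definition NH :: "nat \<Rightarrow> nat \<Rightarrow> nat \<Rightarrow> nat \<Rightarrow> nat \<Rightarrow> int pf_array \<Rightarrow> bool" where
  "NH t m n h k A \<longleftrightarrow>
     m \<ge> k \<and> k \<ge> 1 \<and> n \<ge> h \<and> h \<ge> 1 \<and> m * h = n * k \<and> t \<ge> 1 \<and> t dvd 2 * n * k \<and>
     (let v = 2 * n * k + t; Z = integer_mod_group v; J = subgroup_of_order v t in
        (\<forall>(i, j) \<in> filled_cells m n A. the (A i j) \<in> carrier Z) \<and>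
        (\<forall>i<m. card (filled_in_row n A i) = h) \<and>
        (\<forall>j<n. card (filled_in_col m A j) = k) \<and>
        (\<forall>x \<in> carrier Z - J. count (plus_minus_entries Z m n A) x = 1) \<and>
        (\<forall>x \<in> J. x \<notin># plus_minus_entries Z m n A) \<and>
        (\<forall>i<m. finprod Z (\<lambda>j. the (A i j)) (filled_in_row n A i) \<noteq> \<one>\<^bsub>Z\<^esub>) \<and>
        (\<forall>j<n. finprod Z (\<lambda>i. the (A i j)) (filled_in_col m A j) \<noteq> \<one>\<^bsub>Z\<^esub>))"


section \<open>Simple orderings\<close>

definition list_sum :: "('a, 'b) monoid_scheme \<Rightarrow> 'a list \<Rightarrow> 'a" where
  "list_sum G xs = foldr (\<lambda>x y. x \<otimes>\<^bsub>G\<^esub> y) xs \<one>\<^bsub>G\<^esub>"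

definition simple_ordering :: "('a, 'b) monoid_scheme \<Rightarrow> 'a set \<Rightarrow> 'a list \<Rightarrow> bool" where
  "simple_ordering G T xs \<longleftrightarrow>
     distinct xs \<and> set xs = T \<and>
     (\<forall>ys. strict_sublist ys xs \<and> ys \<noteq> [] \<longrightarrow> list_sum G ys \<noteq> \<one>\<^bsub>G\<^esub>)"

definition simple_array ::
    "('a, 'b) monoid_scheme \<Rightarrow> nat \<Rightarrow> nat \<Rightarrow> 'a pf_array \<Rightarrow>
     (nat \<Rightarrow> 'a list) \<Rightarrow> (nat \<Rightarrow> 'a list) \<Rightarrow> bool" where
  "simple_array G m n A \<omega>r \<omega>c \<longleftrightarrow>
     (\<forall>i<m. simple_ordering G (row_entries n A i) (\<omega>r i)) \<and>
     (\<forall>j<n. simple_ordering G (col_entries m A j) (\<omega>c j))"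


section \<open>Path decompositions of graphs\<close>

datatype 'a ugraph = Graph (verts: "'a set") (edges: "'a set set")

definition subgraph_of :: "'a ugraph \<Rightarrow> 'a ugraph \<Rightarrow> bool" where
  "subgraph_of H K \<longleftrightarrow> verts H \<subseteq> verts K \<and> edges H \<subseteq> edges K"

definition multipartite_graph :: "'a set set \<Rightarrow> 'a ugraph" where
  "multipartite_graph P =
     Graph (\<Union>P) {{x, y} | x y. \<exists>S\<in>P. \<exists>T\<in>P. S \<noteq> T \<and> x \<in> S \<and> y \<in> T}"

text \<open>\<open>K\<close> is a copy of \<open>K\<^bsub>q\<times>r\<^esub>\<close>.\<close>

definition complete_multipartite :: "nat \<Rightarrow> nat \<Rightarrow> 'a ugraph \<Rightarrow> bool" where
  "complete_multipartite q r K \<longleftrightarrow>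
     (\<exists>P. partition_on (verts K) P \<and> finite P \<and> card P = q \<and>
          (\<forall>S\<in>P. finite S \<and> card S = r) \<and> K = multipartite_graph P)"

definition path_graph :: "'a list \<Rightarrow> 'a ugraph" where
  "path_graph xs = Graph (set xs) {{xs ! i, xs ! Suc i} | i. Suc i < length xs}"

definition is_path :: "nat \<Rightarrow> 'a ugraph \<Rightarrow> bool" where
  "is_path l B \<longleftrightarrow> (\<exists>xs. distinct xs \<and> length xs = l + 1 \<and> B = path_graph xs)"

definition path_decomposition :: "nat \<Rightarrow> 'a ugraph \<Rightarrow> 'a ugraph set \<Rightarrow> bool" where
  "path_decomposition l K D \<longleftrightarrow>
     (\<forall>B\<in>D. subgraph_of B K \<and> is_path l B) \<and>
     disjoint_family_on edges D \<and> (\<Union>B\<in>D. edges B) = edges K"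

definition translate :: "('a, 'b) monoid_scheme \<Rightarrow> 'a \<Rightarrow> 'a ugraph \<Rightarrow> 'a ugraph" where
  "translate G g B =
     Graph ((\<lambda>x. x \<otimes>\<^bsub>G\<^esub> g) ` verts B) ((\<lambda>e. (\<lambda>x. x \<otimes>\<^bsub>G\<^esub> g) ` e) ` edges B)"

text \<open>The vertex set is taken to be \<open>\<int>\<^sub>v\<close> itself, not only up to isomorphism.\<close>

definition cyclic_path_decomposition :: "nat \<Rightarrow> int ugraph \<Rightarrow> int ugraph set \<Rightarrow> bool" where
  "cyclic_path_decomposition l K D \<longleftrightarrow>
     path_decomposition l K D \<and>
     (let Z = integer_mod_group (card (verts K)) in
        verts K = carrier Z \<and> (\<forall>B\<in>D. \<forall>g\<in>carrier Z. translate Z g B \<in> D))"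

definition orthogonal_decompositions :: "'a ugraph set \<Rightarrow> 'a ugraph set \<Rightarrow> bool" where
  "orthogonal_decompositions D D' \<longleftrightarrow>
     (\<forall>B\<in>D. \<forall>B'\<in>D'. \<exists>\<^sub>\<le>\<^sub>1 e. e \<in> edges B \<inter> edges B')"

definition partial_sums :: "('a, 'b) monoid_scheme \<Rightarrow> 'a list \<Rightarrow> 'a list" where
  "partial_sums G xs = map (\<lambda>i. list_sum G (take i xs)) [0..<Suc (length xs)]"

text \<open>For \<open>r\<close> lines (rows or columns) with orderings \<open>\<omega> 0, \<dots>, \<omega> (r - 1)\<close>.\<close>

definition assoc_decomposition ::
    "('a, 'b) monoid_scheme \<Rightarrow> nat \<Rightarrow> (nat \<Rightarrow> 'a list) \<Rightarrow> 'a ugraph set" where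
  "assoc_decomposition G r \<omega> =
     {translate G g (path_graph (partial_sums G (\<omega> i))) | g i. g \<in> carrier G \<and> i < r}"

end

theory Submission
  imports Defs
begin

text \<open>An edge of a translated path joins \<open>x\<close> to \<open>x + a\<close>, where \<open>a\<close> is the entry of a cell. Up to
  sign, every element outside \<open>J\<close> is the entry of exactly one cell, and no entry is its own negative;
  hence an edge determines its cell and its starting point \<open>x\<close>, and thereby the line, the position
  on that line and the translation. This gives the two decompositions. A row block and a column block
  can only share edges coming from the unique cell in which that row and that column meet.\<close>

section \<open>Sums along lists and their partial sums\<close>

lemma (in monoid) list_sum_closed [simp]: "set xs \<subseteq> carrier G \<Longrightarrow> list_sum G xs \<in> carrier G"
  by (induction xs) (auto simp: list_sum_def)

lemma (in monoid) list_sum_append: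
  assumes "set xs \<subseteq> carrier G" "set ys \<subseteq> carrier G"
  shows "list_sum G (xs @ ys) = list_sum G xs \<otimes> list_sum G ys"
  using assms
proof (induction xs)
  case Nil
  then show ?case using list_sum_closed[of ys] by (simp add: list_sum_def)
next
  case (Cons x xs)
  then show ?case using list_sum_closed[of ys] list_sum_closed[of xs]
    by (simp add: list_sum_def m_assoc)
qed

lemma (in monoid) list_sum_take_closed:
  "set xs \<subseteq> carrier G \<Longrightarrow> list_sum G (take i xs) \<in> carrier G"
  by (meson list_sum_closed order_trans set_take_subset)

lemma (in monoid) list_sum_take_Suc:
  assumes "set xs \<subseteq> carrier G" "i < length xs"
  shows "list_sum G (take (Suc i) xs) = list_sum G (take i xs) \<otimes> xs ! i"
proof -
  have "xs ! i \<in> carrier G" using assms nth_mem by blast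
  moreover have "set (take i xs) \<subseteq> carrier G" using assms(1) set_take_subset by fast
  ultimately show ?thesis
    using assms(2) by (simp add: take_Suc_conv_app_nth list_sum_append) (simp add: list_sum_def)
qed

text \<open>Links the ordered sums used along paths with the unordered \<open>finprod\<close> in
  which the non-zero sum condition on the array is stated.\<close>

lemma (in comm_monoid) list_sum_distinct:
  assumes "distinct xs" "set xs \<subseteq> carrier G"
  shows "list_sum G xs = (\<Otimes>x\<in>set xs. x)"
  using assms by (induction xs) (auto simp: list_sum_def Pi_def subset_eq)

lemma length_partial_sums [simp]: "length (partial_sums G xs) = Suc (length xs)"
  by (simp add: partial_sums_def)

lemma nth_partial_sums [simp]:
  "i \<le> length xs \<Longrightarrow> partial_sums G xs ! i = list_sum G (take i xs)"
  by (simp add: partial_sums_def nth_append del: upt_Suc)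

lemma (in monoid) set_partial_sums:
  "set xs \<subseteq> carrier G \<Longrightarrow> set (partial_sums G xs) \<subseteq> carrier G"
  by (auto simp: partial_sums_def list_sum_take_closed simp del: upt_Suc)

text \<open>Two equal partial sums would enclose a nonempty run of consecutive terms with trivial
  sum. Simplicity excludes this for proper runs, and \<open>nz\<close> excludes it for the whole
  list.\<close>

lemma (in group) distinct_partial_sums:
  assumes xs: "simple_ordering G T xs" "set xs \<subseteq> carrier G" and nz: "list_sum G xs \<noteq> \<one>"
  shows "distinct (partial_sums G xs)"
proof -
  have "list_sum G (take i xs) \<noteq> list_sum G (take j xs)" if ij: "i < j" "j \<le> length xs" for i j
  proof
    assume eq: "list_sum G (take i xs) = list_sum G (take j xs)"
    let ?ys = "drop i (take j xs)"
    have split: "take j xs = take i xs @ ?ys"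
      using ij by (metis append_take_drop_id less_imp_le min.absorb1 take_take)
    have sub: "set ?ys \<subseteq> carrier G"
      using xs(2) by (meson order_trans set_drop_subset set_take_subset)
    have sub': "set (take i xs) \<subseteq> carrier G" using xs(2) set_take_subset by fast
    have "list_sum G (take i xs) \<otimes> list_sum G ?ys = list_sum G (take i xs) \<otimes> \<one>"
      using eq split list_sum_append[OF sub' sub] sub' by (metis list_sum_closed r_one)
    then have one: "list_sum G ?ys = \<one>" using sub sub' by (simp add: l_cancel)
    have "?ys \<noteq> []" using ij by simp
    moreover have "sublist ?ys xs"
      by (meson sublist_drop sublist_take sublist_order.order_trans)
    ultimately show False
      using one nz xs(1) by (metis simple_ordering_def sublist_order.less_le)
  qed
  then have "inj_on (\<lambda>i. list_sum G (take i xs)) {..length xs}"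
    by (intro linorder_inj_onI') auto
  then show ?thesis
    by (auto simp: partial_sums_def distinct_map inj_on_def less_Suc_eq_le simp del: upt_Suc)
qed

section \<open>Edges of translated paths and of the coset graph\<close>

lemma translate_path_graph:
  "translate G g (path_graph xs) = path_graph (map (\<lambda>x. x \<otimes>\<^bsub>G\<^esub> g) xs)"
  unfolding translate_def path_graph_def ugraph.sel setcompr_eq_image image_image
  by (auto intro!: image_cong)

lemma (in monoid) translate_translate_path_graph:
  assumes "set xs \<subseteq> carrier G" "g \<in> carrier G" "g' \<in> carrier G"
  shows "translate G g' (translate G g (path_graph xs)) = translate G (g \<otimes> g') (path_graph xs)"
proof -
  have "map (\<lambda>x. x \<otimes> g \<otimes> g') xs = map (\<lambda>x. x \<otimes> (g \<otimes> g')) xs"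
    using assms by (auto simp: m_assoc)
  then show ?thesis by (simp only: translate_path_graph map_map comp_def)
qed

text \<open>Describes an edge by a starting point and a difference instead of two consecutive
  vertices. Commutativity moves the translation \<open>g\<close> past the entry
  \<open>xs ! p\<close>, so the difference is the entry itself.\<close>

lemma (in comm_group) edges_translated_path:
  assumes "set xs \<subseteq> carrier G" "g \<in> carrier G"
  shows "edges (translate G g (path_graph (partial_sums G xs))) =
    {{x, x \<otimes> xs ! p} | x p. p < length xs \<and> x = list_sum G (take p xs) \<otimes> g}"
proof -
  have step: "list_sum G (take (Suc p) xs) \<otimes> g = list_sum G (take p xs) \<otimes> g \<otimes> xs ! p"
    if "p < length xs" for p
  proof -
    have "xs ! p \<in> carrier G" using assms(1) nth_mem[OF that] by blast
    then show ?thesis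
      using assms(2) list_sum_take_closed[OF assms(1)]
      unfolding list_sum_take_Suc[OF assms(1) that] by (simp add: m_ac)
  qed
  have "{{list_sum G (take p xs) \<otimes> g, list_sum G (take (Suc p) xs) \<otimes> g} |p. p < length xs} =
      {{x, x \<otimes> xs ! p} | x p. p < length xs \<and> x = list_sum G (take p xs) \<otimes> g}"
    by (intro Collect_cong) (metis step)
  moreover have "edges (translate G g (path_graph (partial_sums G xs))) =
      {{list_sum G (take p xs) \<otimes> g, list_sum G (take (Suc p) xs) \<otimes> g} |p. p < length xs}"
    unfolding translate_path_graph unfolding path_graph_def ugraph.sel
    by (intro Collect_cong ex_cong1) auto
  ultimately show ?thesis by simp
qed

text \<open>Two elements lie in different cosets exactly when their difference is outside
  \<open>J\<close>. The graph is thus the Cayley graph whose connection set is the complement of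
  \<open>J\<close>.\<close>

lemma (in comm_group) edges_multipartite_rcosets:
  assumes J: "subgroup J G"
  shows "edges (multipartite_graph (rcosets J)) =
    {{x, x \<otimes> a} | x a. x \<in> carrier G \<and> a \<in> carrier G - J}"
proof (intro equalityI subsetI)
  fix E assume "E \<in> edges (multipartite_graph (rcosets J))"
  then obtain x y S T where E: "E = {x, y}" and ST: "S \<in> rcosets J" "T \<in> rcosets J" "S \<noteq> T"
    and x: "x \<in> S" and y: "y \<in> T"
    by (auto simp: multipartite_graph_def)
  have xy: "x \<in> carrier G" "y \<in> carrier G"
    using ST x y rcosets_part_G[OF J] by blast+
  have "S = J #> x" using ST(1) x J repr_independence xy
    by (auto simp: RCOSETS_def)
  have "inv x \<otimes> y \<notin> J"
  proof
    assume "inv x \<otimes> y \<in> J"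
    moreover have "y = (inv x \<otimes> y) \<otimes> x"
      using xy by (metis inv_closed l_one m_assoc m_closed m_comm r_inv)
    ultimately have "y \<in> S" using \<open>S = J #> x\<close> by (auto simp: r_coset_def)
    then show False using rcos_disjoint[OF J] ST y by (auto simp: pairwise_def disjnt_def)
  qed
  moreover have "y = x \<otimes> (inv x \<otimes> y)" using xy by (metis inv_closed l_one m_assoc r_inv)
  ultimately have "E = {x, x \<otimes> (inv x \<otimes> y)} \<and> x \<in> carrier G \<and> inv x \<otimes> y \<in> carrier G - J"
    using E xy by simp
  then show "E \<in> {{x, x \<otimes> a} | x a. x \<in> carrier G \<and> a \<in> carrier G - J}"
    by blast
next
  fix E assume "E \<in> {{x, x \<otimes> a} | x a. x \<in> carrier G \<and> a \<in> carrier G - J}"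
  then obtain x a where E: "E = {x, x \<otimes> a}" and x: "x \<in> carrier G" and a: "a \<in> carrier G" "a \<notin> J"
    by blast
  \<comment> \<open>If the cosets agreed, cancelling \<open>x\<close> would put \<open>a\<close>
    into \<open>J\<close>.\<close>
  have "J #> x \<noteq> J #> (x \<otimes> a)"
  proof
    assume "J #> x = J #> (x \<otimes> a)"
    then have "x \<otimes> a \<in> J #> x" using rcos_self[OF _ J] x a by simp
    then obtain b where "b \<in> J" "x \<otimes> a = b \<otimes> x" by (auto simp: r_coset_def)
    then show False using x a subgroup.mem_carrier[OF J] by (simp add: m_comm[of b])
  qed
  moreover have "J #> x \<in> rcosets J" "J #> (x \<otimes> a) \<in> rcosets J"
    using x a by (auto simp: RCOSETS_def)
  moreover have "x \<in> J #> x" "x \<otimes> a \<in> J #> (x \<otimes> a)"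
    using rcos_self[OF _ J] x a by auto
  ultimately show "E \<in> edges (multipartite_graph (rcosets J))"
    using E unfolding multipartite_graph_def ugraph.sel by blast
qed

text \<open>The cosets themselves are the parts: they partition the carrier, each has the size of
  \<open>J\<close>, and Lagrange's theorem counts them.\<close>

lemma (in group) complete_multipartite_rcosets:
  assumes J: "subgroup J G" and fin: "finite (carrier G)"
  shows "complete_multipartite (order G div card J) (card J) (multipartite_graph (rcosets J))"
  unfolding complete_multipartite_def
proof (intro exI conjI ballI)
  have finJ: "finite J" using J fin by (meson finite_subset subgroup.subset)
  have pos: "card J > 0" using finJ J subgroup.one_closed card_gt_0_iff by blast
  have sub: "J \<subseteq> carrier G" using J by (rule subgroup.subset)
  show "partition_on (verts (multipartite_graph (rcosets J))) (rcosets J)"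
    using rcos_disjoint[OF J] rcos_self[OF _ J]
    by (fastforce simp: partition_on_def multipartite_graph_def disjoint_def pairwise_def disjnt_def
        RCOSETS_def)
  show "finite (rcosets J)"
    using fin by (simp add: RCOSETS_def)
  show "card (rcosets J) = order G div card J"
    using lagrange[OF J] pos by (metis nonzero_mult_div_cancel_right less_numeral_extra(3))
  fix S assume "S \<in> rcosets J"
  then show "card S = card J" using card_rcosets_equal[OF _ sub] by simp
  then show "finite S" using pos by (metis card_ge_0_finite)
qed simp

section \<open>Entries that represent the complement of J up to sign\<close>

text \<open>Abstracts the condition that the entries and their inverses hit every element outside
  \<open>J\<close> exactly once: \<open>covers\<close> is existence, \<open>e_inj\<close> and
  \<open>e_noninv\<close> are uniqueness. The case \<open>c = c'\<close> of \<open>e_noninv\<close>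
  rules out entries of order two.\<close>

locale half_set = comm_group G for G (structure) +
  fixes J :: "'a set" and F :: "'c set" and e :: "'c \<Rightarrow> 'a"
  assumes J: "subgroup J G"
    and e_closed: "c \<in> F \<Longrightarrow> e c \<in> carrier G"
    and e_notin: "c \<in> F \<Longrightarrow> e c \<notin> J"
    and covers: "x \<in> carrier G \<Longrightarrow> x \<notin> J \<Longrightarrow> \<exists>c\<in>F. x = e c \<or> x = inv (e c)"
    and e_inj: "inj_on e F"
    and e_noninv: "c \<in> F \<Longrightarrow> c' \<in> F \<Longrightarrow> e c \<noteq> inv (e c')"
begin

text \<open>If the starting points agree, cancel them and use \<open>e_inj\<close>. Otherwise the
  edge is traversed in opposite directions, which makes the entries mutually inverse, against
  \<open>e_noninv\<close>.\<close>

lemma edge_determines_cell: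
  assumes "{x, x \<otimes> e c} = {y, y \<otimes> e c'}"
    and x: "x \<in> carrier G" and y: "y \<in> carrier G" and c: "c \<in> F" "c' \<in> F"
  shows "x = y \<and> c = c'"
proof (cases "x = y")
  case True
  then have "x \<otimes> e c = x \<otimes> e c'" using assms(1) by (auto simp: doubleton_eq_iff)
  then show ?thesis using True x c e_closed e_inj by (simp add: inj_on_eq_iff)
next
  case False
  then have "x = y \<otimes> e c'" "y = x \<otimes> e c" using assms(1) by (auto simp: doubleton_eq_iff)
  then have "x \<otimes> (e c \<otimes> e c') = x \<otimes> \<one>" using x e_closed c by (simp flip: m_assoc)
  then have "e c \<otimes> e c' = \<one>" using x e_closed c by (metis l_cancel m_closed one_closed)
  then have "e c = inv (e c')" using e_closed c by (simp add: inv_equality)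
  then show ?thesis using e_noninv c by blast
qed

lemma edges_half:
  "edges (multipartite_graph (rcosets J)) = {{x, x \<otimes> e c} | x c. x \<in> carrier G \<and> c \<in> F}"
  unfolding edges_multipartite_rcosets[OF J]
proof (intro equalityI subsetI)
  fix E assume "E \<in> {{x, x \<otimes> a} | x a. x \<in> carrier G \<and> a \<in> carrier G - J}"
  then obtain x a where E: "E = {x, x \<otimes> a}" and x: "x \<in> carrier G" and a: "a \<in> carrier G" "a \<notin> J"
    by blast
  from covers[OF a] obtain c where c: "c \<in> F" "a = e c \<or> a = inv (e c)" by blast
  show "E \<in> {{x, x \<otimes> e c} | x c. x \<in> carrier G \<and> c \<in> F}"
  proof (cases "a = e c")
    case False
    \<comment> \<open>Here \<open>a\<close> is the inverse of an entry, so the edge is read from its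
      other end.\<close>
    then have "x = (x \<otimes> a) \<otimes> e c" using x c e_closed by (simp add: m_assoc)
    then have "E = {x \<otimes> a, (x \<otimes> a) \<otimes> e c}" using E by auto
    then show ?thesis using x a c by blast
  qed (use E x c in blast)
qed (use e_closed e_notin in blast)

end

section \<open>The decomposition given by one family of lines\<close>

text \<open>Treats rows and columns at once: \<open>line\<close> sends a cell to its row or to its
  column, \<open>r\<close> is the number of lines and \<open>l\<close> the number of cells on
  each.\<close>

locale ordered_lines = half_set +
  fixes r l :: nat and line :: "'c \<Rightarrow> nat" and \<omega> :: "nat \<Rightarrow> 'a list"
  assumes line_less: "c \<in> F \<Longrightarrow> line c < r"
    and card_line: "i < r \<Longrightarrow> card {c \<in> F. line c = i} = l"
    and ordering: "i < r \<Longrightarrow> simple_ordering G (e ` {c \<in> F. line c = i}) (\<omega> i)"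
    and sum_neq: "i < r \<Longrightarrow> list_sum G (\<omega> i) \<noteq> \<one>"
begin

abbreviation block :: "'a \<Rightarrow> nat \<Rightarrow> 'a ugraph" where
  "block g i \<equiv> translate G g (path_graph (partial_sums G (\<omega> i)))"

lemma set_line: "i < r \<Longrightarrow> set (\<omega> i) = e ` {c \<in> F. line c = i}"
  using ordering by (simp add: simple_ordering_def)

lemma distinct_line: "i < r \<Longrightarrow> distinct (\<omega> i)"
  using ordering by (simp add: simple_ordering_def)

lemma line_closed: "i < r \<Longrightarrow> set (\<omega> i) \<subseteq> carrier G"
  using set_line e_closed by auto

lemma length_line:
  assumes "i < r" shows "length (\<omega> i) = l"
proof -
  have "inj_on e {c \<in> F. line c = i}" using e_inj by (rule inj_on_subset) auto
  then show ?thesis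
    using assms by (simp add: set_line card_image card_line flip: distinct_card[OF distinct_line])
qed

text \<open>Traces an edge of a block back to a position and a cell, the form in which
  \<open>edge_determines_cell\<close> applies.\<close>

lemma block_edgeE:
  assumes "E \<in> edges (block g i)" "i < r" "g \<in> carrier G"
  obtains p c where "p < length (\<omega> i)" "c \<in> F" "line c = i" "\<omega> i ! p = e c"
    "list_sum G (take p (\<omega> i)) \<otimes> g \<in> carrier G"
    "E = {list_sum G (take p (\<omega> i)) \<otimes> g, list_sum G (take p (\<omega> i)) \<otimes> g \<otimes> e c}"
proof -
  obtain p where p: "p < length (\<omega> i)"
    "E = {list_sum G (take p (\<omega> i)) \<otimes> g, list_sum G (take p (\<omega> i)) \<otimes> g \<otimes> \<omega> i ! p}"
    using assms by (auto simp: edges_translated_path line_closed)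
  have "\<omega> i ! p \<in> e ` {c \<in> F. line c = i}" using p assms nth_mem set_line by blast
  then obtain c where "c \<in> F" "line c = i" "\<omega> i ! p = e c" by blast
  moreover have "list_sum G (take p (\<omega> i)) \<otimes> g \<in> carrier G"
    using assms line_closed list_sum_take_closed by simp
  ultimately show ?thesis using that p by metis
qed

text \<open>The common edge fixes the cell and the starting point. The cell gives the line,
  distinctness of the entries on it gives the position, and cancelling the partial sum up to that
  position gives the translation.\<close>

lemma block_unique:
  assumes "E \<in> edges (block g i)" "E \<in> edges (block g' i')"
    and i: "i < r" "i' < r" and g: "g \<in> carrier G" "g' \<in> carrier G"
  shows "i = i' \<and> g = g'"
proof -
  obtain p c where p: "p < length (\<omega> i)" "c \<in> F" "line c = i" "\<omega> i ! p = e c"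
    "list_sum G (take p (\<omega> i)) \<otimes> g \<in> carrier G"
    "E = {list_sum G (take p (\<omega> i)) \<otimes> g, list_sum G (take p (\<omega> i)) \<otimes> g \<otimes> e c}"
    by (rule block_edgeE[OF assms(1) i(1) g(1)])
  obtain p' c' where p': "p' < length (\<omega> i')" "c' \<in> F" "line c' = i'" "\<omega> i' ! p' = e c'"
    "list_sum G (take p' (\<omega> i')) \<otimes> g' \<in> carrier G"
    "E = {list_sum G (take p' (\<omega> i')) \<otimes> g', list_sum G (take p' (\<omega> i')) \<otimes> g' \<otimes> e c'}"
    by (rule block_edgeE[OF assms(2) i(2) g(2)])
  have eq: "list_sum G (take p (\<omega> i)) \<otimes> g = list_sum G (take p' (\<omega> i')) \<otimes> g'" "c = c'"
    using edge_determines_cell[of _ c _ c'] p p' by metis+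
  then have "i = i'" using p p' by simp
  moreover have "p = p'"
    using p p' eq(2) \<open>i = i'\<close> distinct_line[OF i(1)] nth_eq_iff_index_eq by metis
  ultimately have "list_sum G (take p (\<omega> i)) \<otimes> g = list_sum G (take p (\<omega> i)) \<otimes> g'"
    using eq(1) by (simp only:)
  then have "g = g'"
    using g list_sum_take_closed[OF line_closed[OF i(1)]] by (simp only: l_cancel)
  with \<open>i = i'\<close> show ?thesis by simp
qed

lemma is_path_block:
  assumes "i < r" "g \<in> carrier G" shows "is_path l (block g i)"
  unfolding is_path_def translate_path_graph
proof (rule exI, intro conjI)
  have "set (partial_sums G (\<omega> i)) \<subseteq> carrier G"
    using assms by (simp add: set_partial_sums line_closed)
  then have "inj_on (\<lambda>x. x \<otimes> g) (set (partial_sums G (\<omega> i)))"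
    using assms by (auto simp: inj_on_def subset_eq)
  then show "distinct (map (\<lambda>x. x \<otimes> g) (partial_sums G (\<omega> i)))"
    using distinct_partial_sums[OF ordering line_closed sum_neq] assms by (simp add: distinct_map)
qed (use assms length_line in simp_all)

lemma edges_blocks:
  "(\<Union>B\<in>assoc_decomposition G r \<omega>. edges B) = edges (multipartite_graph (rcosets J))"
  unfolding edges_half
proof (intro equalityI subsetI)
  fix E assume "E \<in> (\<Union>B\<in>assoc_decomposition G r \<omega>. edges B)"
  then obtain g i where "g \<in> carrier G" "i < r" "E \<in> edges (block g i)"
    by (auto simp: assoc_decomposition_def)
  then show "E \<in> {{x, x \<otimes> e c} | x c. x \<in> carrier G \<and> c \<in> F}"
    by (elim block_edgeE) blast+
next
  fix E assume "E \<in> {{x, x \<otimes> e c} | x c. x \<in> carrier G \<and> c \<in> F}"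
  then obtain x c where E: "E = {x, x \<otimes> e c}" and x: "x \<in> carrier G" and c: "c \<in> F" by blast
  let ?i = "line c"
  have i: "?i < r" using c by (rule line_less)
  have "e c \<in> set (\<omega> ?i)" using set_line[OF i] c by blast
  then obtain p where p: "p < length (\<omega> ?i)" "\<omega> ?i ! p = e c" by (auto simp: in_set_conv_nth)
  let ?s = "list_sum G (take p (\<omega> ?i))"
  have s: "?s \<in> carrier G" using list_sum_take_closed line_closed i by blast
  then have g: "inv ?s \<otimes> x \<in> carrier G" using x by simp
  \<comment> \<open>The translation is chosen to move the partial sum just before the entry of
    \<open>c\<close> onto \<open>x\<close>.\<close>
  have "x = ?s \<otimes> (inv ?s \<otimes> x)" using s x by (simp flip: m_assoc)
  then have "E \<in> edges (block (inv ?s \<otimes> x) ?i)"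
    unfolding edges_translated_path[OF line_closed[OF i] g] using E p by auto
  then show "E \<in> (\<Union>B\<in>assoc_decomposition G r \<omega>. edges B)"
    using g i unfolding assoc_decomposition_def by blast
qed

lemma verts_block:
  assumes "i < r" "g \<in> carrier G" shows "verts (block g i) \<subseteq> carrier G"
  using assms set_partial_sums[OF line_closed[OF assms(1)]]
  by (auto simp: translate_def path_graph_def)

lemma path_decomposition_lines:
  "path_decomposition l (multipartite_graph (rcosets J)) (assoc_decomposition G r \<omega>)"
  unfolding path_decomposition_def
proof (intro conjI ballI)
  fix B assume B: "B \<in> assoc_decomposition G r \<omega>"
  then obtain g i where gi: "g \<in> carrier G" "i < r" "B = block g i"
    by (auto simp: assoc_decomposition_def)
  show "is_path l B" using gi is_path_block by simp
  have "verts B \<subseteq> carrier G" using gi verts_block by simp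
  then show "subgraph_of B (multipartite_graph (rcosets J))"
    using B edges_blocks rcosets_part_G[OF J] by (auto simp: subgraph_of_def multipartite_graph_def)
next
  \<comment> \<open>The family is indexed by the blocks themselves, so a shared edge only has to
    force equal blocks; \<open>block_unique\<close> even gives equal lines and translations.\<close>
  show "disjoint_family_on edges (assoc_decomposition G r \<omega>)"
    unfolding disjoint_family_on_def assoc_decomposition_def
  proof (clarify, rule ccontr)
    fix g i g' i'
    assume gi: "g \<in> carrier G" "i < r" "g' \<in> carrier G" "i' < r" "block g i \<noteq> block g' i'"
    assume "edges (block g i) \<inter> edges (block g' i') \<noteq> {}"
    then obtain E where "E \<in> edges (block g i)" "E \<in> edges (block g' i')" by blast
    then show False using block_unique[of E g i g' i'] gi by simp
  qed
qed (rule edges_blocks)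

lemma translate_block:
  assumes "B \<in> assoc_decomposition G r \<omega>" "g' \<in> carrier G"
  shows "translate G g' B \<in> assoc_decomposition G r \<omega>"
proof -
  obtain g i where gi: "g \<in> carrier G" "i < r" "B = block g i"
    using assms by (auto simp: assoc_decomposition_def)
  then have "translate G g' B = block (g \<otimes> g') i"
    using assms(2) by (simp add: translate_translate_path_graph set_partial_sums line_closed)
  then show ?thesis using gi assms(2) unfolding assoc_decomposition_def by blast
qed

end

section \<open>Orthogonality of two families of lines\<close>

text \<open>A common edge of two blocks comes from a cell lying on both lines. By
  \<open>meet\<close> there is at most one such cell, and within a fixed block a cell yields only
  one edge.\<close>

lemma orthogonal_lines:
  assumes R: "ordered_lines G J F e r l line \<omega>" and C: "ordered_lines G J F e r' l' line' \<omega>'"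
    and meet: "inj_on (\<lambda>c. (line c, line' c)) F"
  shows "orthogonal_decompositions (assoc_decomposition G r \<omega>) (assoc_decomposition G r' \<omega>')"
  unfolding orthogonal_decompositions_def
proof (intro ballI Uniq_I)
  fix B B' E1 E2
  assume B: "B \<in> assoc_decomposition G r \<omega>" "B' \<in> assoc_decomposition G r' \<omega>'"
    and E: "E1 \<in> edges B \<inter> edges B'" "E2 \<in> edges B \<inter> edges B'"
  interpret R: ordered_lines G J F e r l line \<omega> by fact
  interpret C: ordered_lines G J F e r' l' line' \<omega>' by fact
  obtain g i where gi: "g \<in> carrier G" "i < r" "B = R.block g i"
    using B by (auto simp: assoc_decomposition_def)
  obtain g' j where gj: "g' \<in> carrier G" "j < r'" "B' = C.block g' j"
    using B by (auto simp: assoc_decomposition_def)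
  have cell: "\<exists>p c. p < length (\<omega> i) \<and> c \<in> F \<and> line c = i \<and> line' c = j \<and> \<omega> i ! p = e c \<and>
      E = {list_sum G (take p (\<omega> i)) \<otimes>\<^bsub>G\<^esub> g, list_sum G (take p (\<omega> i)) \<otimes>\<^bsub>G\<^esub> g \<otimes>\<^bsub>G\<^esub> e c}"
    if "E \<in> edges B \<inter> edges B'" for E
  proof -
    have E: "E \<in> edges (R.block g i)" "E \<in> edges (C.block g' j)"
      using that gi(3) gj(3) by simp_all
    obtain p c where p: "p < length (\<omega> i)" "c \<in> F" "line c = i" "\<omega> i ! p = e c"
      "list_sum G (take p (\<omega> i)) \<otimes>\<^bsub>G\<^esub> g \<in> carrier G"
      "E = {list_sum G (take p (\<omega> i)) \<otimes>\<^bsub>G\<^esub> g, list_sum G (take p (\<omega> i)) \<otimes>\<^bsub>G\<^esub> g \<otimes>\<^bsub>G\<^esub> e c}"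
      by (rule R.block_edgeE[OF E(1) gi(2,1)])
    obtain p' c' where p': "p' < length (\<omega>' j)" "c' \<in> F" "line' c' = j" "\<omega>' j ! p' = e c'"
      "list_sum G (take p' (\<omega>' j)) \<otimes>\<^bsub>G\<^esub> g' \<in> carrier G"
      "E = {list_sum G (take p' (\<omega>' j)) \<otimes>\<^bsub>G\<^esub> g', list_sum G (take p' (\<omega>' j)) \<otimes>\<^bsub>G\<^esub> g' \<otimes>\<^bsub>G\<^esub> e c'}"
      by (rule C.block_edgeE[OF E(2) gj(2,1)])
    \<comment> \<open>Both families rest on the same half-set, so the cells read off from the two
      blocks can be compared.\<close>
    have "c = c'" using R.edge_determines_cell[of _ c _ c'] p p' by metis
    then show ?thesis using p p' by blast
  qed
  obtain p1 c1 where 1: "p1 < length (\<omega> i)" "c1 \<in> F" "line c1 = i" "line' c1 = j" "\<omega> i ! p1 = e c1"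
      "E1 = {list_sum G (take p1 (\<omega> i)) \<otimes>\<^bsub>G\<^esub> g, list_sum G (take p1 (\<omega> i)) \<otimes>\<^bsub>G\<^esub> g \<otimes>\<^bsub>G\<^esub> e c1}"
    using cell[OF E(1)] by blast
  obtain p2 c2 where 2: "p2 < length (\<omega> i)" "c2 \<in> F" "line c2 = i" "line' c2 = j" "\<omega> i ! p2 = e c2"
      "E2 = {list_sum G (take p2 (\<omega> i)) \<otimes>\<^bsub>G\<^esub> g, list_sum G (take p2 (\<omega> i)) \<otimes>\<^bsub>G\<^esub> g \<otimes>\<^bsub>G\<^esub> e c2}"
    using cell[OF E(2)] by blast
  have "c1 = c2" using meet 1 2 by (auto simp: inj_on_def)
  \<comment> \<open>The translation \<open>g\<close> is fixed together with \<open>B\<close>, so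
    only the position could still differ.\<close>
  moreover have "p1 = p2"
    using 1 2 \<open>c1 = c2\<close> R.distinct_line[OF gi(2)] nth_eq_iff_index_eq by metis
  ultimately show "E1 = E2" using 1 2 by simp
qed

section \<open>From multiplicities and line conditions to the locales\<close>

lemma count_pair_sum:
  assumes "finite F"
  shows "count (\<Sum>c\<in>F. {#f c, g c#}) x = card {c \<in> F. f c = x} + card {c \<in> F. g c = x}"
proof -
  have "count (\<Sum>c\<in>F. {#f c, g c#}) x =
      (\<Sum>c\<in>F. (if f c = x then 1 else 0) + (if g c = x then 1 else 0))"
    unfolding count_sum by (intro sum.cong) auto
  also have "\<dots> = card {c \<in> F. f c = x} + card {c \<in> F. g c = x}"
    using assms by (simp add: sum.distrib flip: sum.inter_filter)
  finally show ?thesis .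
qed

text \<open>Each index already contributes one to the count of its own entry. A total of one leaves
  room neither for a second index with that entry nor for an inverse entry equal to it.\<close>

lemma (in comm_group) half_set_if_count_eq_1:
  assumes J: "subgroup J G" and fin: "finite F" and closed: "\<And>c. c \<in> F \<Longrightarrow> e c \<in> carrier G"
  defines "M \<equiv> (\<Sum>c\<in>F. {#e c, inv (e c)#})"
  assumes one: "\<And>x. x \<in> carrier G - J \<Longrightarrow> count M x = 1"
    and none: "\<And>x. x \<in> J \<Longrightarrow> x \<notin># M"
  shows "half_set G J F e"
proof -
  have count: "count M x = card {c \<in> F. e c = x} + card {c \<in> F. inv (e c) = x}" for x
    unfolding M_def by (rule count_pair_sum[OF fin])
  have notin: "e c \<notin> J" if "c \<in> F" for c
  proof
    assume "e c \<in> J"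
    then have "count M (e c) = 0" using none by (simp add: not_in_iff)
    then have "{d \<in> F. e d = e c} = {}" using count fin by simp
    then show False using that by blast
  qed
  then have ones: "card {d \<in> F. e d = e c} + card {d \<in> F. inv (e d) = e c} = 1" if "c \<in> F" for c
    using one[of "e c"] closed that count by simp
  have pos: "card {d \<in> F. e d = e c} \<ge> 1" if "c \<in> F" for c
    using that fin by (auto simp: Suc_le_eq card_gt_0_iff)
  show ?thesis
  proof (intro half_set.intro half_set_axioms.intro comm_group_axioms)
    show "inj_on e F"
    proof (rule inj_onI)
      fix c d assume cd: "c \<in> F" "d \<in> F" "e c = e d"
      have "card {d \<in> F. e d = e c} = 1" using ones[OF cd(1)] pos[OF cd(1)] by linarith
      then obtain b where "{d \<in> F. e d = e c} = {b}" by (auto simp: card_1_singleton_iff)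
      moreover have "c \<in> {d \<in> F. e d = e c}" "d \<in> {d \<in> F. e d = e c}" using cd by simp_all
      ultimately show "c = d" by (metis singletonD)
    qed
    show "e c \<noteq> inv (e d)" if cd: "c \<in> F" "d \<in> F" for c d
    proof
      assume "e c = inv (e d)"
      then have "d \<in> {d \<in> F. inv (e d) = e c}" using cd by simp
      moreover have "card {d \<in> F. inv (e d) = e c} = 0"
        using ones[OF cd(1)] pos[OF cd(1)] by linarith
      ultimately show False using fin by auto
    qed
    show "\<exists>c\<in>F. x = e c \<or> x = inv (e c)" if "x \<in> carrier G" "x \<notin> J" for x
    proof (rule ccontr)
      assume "\<not> ?thesis"
      then have "{c \<in> F. e c = x} = {}" "{c \<in> F. inv (e c) = x} = {}" by auto
      then have "count M x = 0" by (simp only: count card.empty)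
      then show False using one[of x] that by simp
    qed
  qed (use J closed notin in simp_all)
qed

text \<open>The array conditions count and sum over column indices within a row, or row indices
  within a column. The map \<open>cell i\<close> carries such an index set \<open>S i\<close> to the
  cells of line \<open>i\<close>.\<close>

lemma (in half_set) ordered_linesI:
  assumes "\<And>c. c \<in> F \<Longrightarrow> line c < r"
    and bij: "\<And>i. i < r \<Longrightarrow> bij_betw (cell i) (S i) {c \<in> F. line c = i}"
    and card: "\<And>i. i < r \<Longrightarrow> card (S i) = l"
    and ord: "\<And>i. i < r \<Longrightarrow> simple_ordering G ((\<lambda>s. e (cell i s)) ` S i) (\<omega> i)"
    and nz: "\<And>i. i < r \<Longrightarrow> finprod G (\<lambda>s. e (cell i s)) (S i) \<noteq> \<one>"
  shows "ordered_lines G J F e r l line \<omega>"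
proof unfold_locales
  fix i assume i: "i < r"
  have img: "cell i ` S i = {c \<in> F. line c = i}" and inj: "inj_on (cell i) (S i)"
    using bij[OF i] by (auto simp: bij_betw_def)
  show "card {c \<in> F. line c = i} = l" using bij_betw_same_card[OF bij[OF i]] card[OF i] by simp
  show so: "simple_ordering G (e ` {c \<in> F. line c = i}) (\<omega> i)"
    using ord[OF i] by (simp add: image_image flip: img)
  \<comment> \<open>No entry repeats on a line, so the sum over the set of entries equals the sum
    over the indices.\<close>
  have inj': "inj_on (\<lambda>s. e (cell i s)) (S i)"
    using comp_inj_on[OF inj inj_on_subset[OF e_inj]] img by (auto simp: comp_def)
  have closed: "(\<lambda>s. e (cell i s)) ` S i \<subseteq> carrier G" using img e_closed by blast
  have "list_sum G (\<omega> i) = (\<Otimes>x\<in>(\<lambda>s. e (cell i s)) ` S i. x)"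
    using list_sum_distinct[of "\<omega> i"] ord[OF i] closed by (simp add: simple_ordering_def)
  also have "\<dots> = finprod G (\<lambda>s. e (cell i s)) (S i)"
    by (rule finprod_reindex[OF _ inj']) (use closed in auto)
  finally show "list_sum G (\<omega> i) \<noteq> \<one>" using nz[OF i] by simp
qed (use assms(1) in blast)

section \<open>Application to the rows and columns of the array\<close>

lemma card_carrier_integer_mod_group: "v > 0 \<Longrightarrow> card (carrier (integer_mod_group v)) = v"
  by (simp add: carrier_integer_mod_group)

theorem proposition2p9:
  fixes t m n h k :: nat and A :: "int pf_array" and \<omega>r \<omega>c :: "nat \<Rightarrow> int list"
  defines "Z \<equiv> integer_mod_group (2 * n * k + t)"
  defines "J \<equiv> subgroup_of_order (2 * n * k + t) t"
  defines "K \<equiv> multipartite_graph (rcosets\<^bsub>Z\<^esub> J)"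
  defines "Dr \<equiv> assoc_decomposition Z m \<omega>r"
  defines "Dc \<equiv> assoc_decomposition Z n \<omega>c"
  assumes "NH t m n h k A"
    and "simple_array Z m n A \<omega>r \<omega>c"
  shows "(complete_multipartite ((2 * m * h + t) div t) t K \<and> cyclic_path_decomposition h K Dr) \<and>
    (complete_multipartite ((2 * n * k + t) div t) t K \<and> cyclic_path_decomposition k K Dc) \<and>
    orthogonal_decompositions Dr Dc"
proof -
  let ?v = "2 * n * k + t" and ?F = "filled_cells m n A"
  let ?e = "\<lambda>(i, j). the (A i j)"
  \<comment> \<open>Since \<open>m * h = n * k\<close>, both vertex counts agree and one graph
    \<open>K\<close> serves both decompositions.\<close>
  have mh: "2 * m * h + t = ?v" and t: "t \<ge> 1" "t dvd 2 * n * k"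
    and entry: "\<forall>(i, j)\<in>?F. the (A i j) \<in> carrier Z"
    and row: "\<And>i. i < m \<Longrightarrow> card (filled_in_row n A i) = h"
      "\<And>i. i < m \<Longrightarrow> finprod Z (\<lambda>j. the (A i j)) (filled_in_row n A i) \<noteq> \<one>\<^bsub>Z\<^esub>"
    and col: "\<And>j. j < n \<Longrightarrow> card (filled_in_col m A j) = k"
      "\<And>j. j < n \<Longrightarrow> finprod Z (\<lambda>i. the (A i j)) (filled_in_col m A j) \<noteq> \<one>\<^bsub>Z\<^esub>"
    and one: "\<And>x. x \<in> carrier Z - J \<Longrightarrow> count (plus_minus_entries Z m n A) x = 1"
    and none: "\<And>x. x \<in> J \<Longrightarrow> x \<notin># plus_minus_entries Z m n A"
    using assms(6) unfolding NH_def Let_def Z_def J_def by (auto simp: mult.assoc)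
  have v: "?v > 0" "t dvd ?v" using t by auto
  interpret comm_group Z unfolding Z_def by simp
  \<comment> \<open>The definite description of \<open>J\<close> is replaced by the explicit
    subgroup of multiples of \<open>?v div t\<close>.\<close>
  have J: "subgroup J Z" and cardJ: "card J = t"
    using subgroup_of_order_multiples[OF v] subgroup_of_order_eq[OF v] by (simp_all add: J_def Z_def)
  have carrier: "card (carrier Z) = ?v"
    unfolding Z_def by (rule card_carrier_integer_mod_group[OF v(1)])
  have finZ: "finite (carrier Z)"
    by (rule card_ge_0_finite) (use carrier v(1) in \<open>simp only:\<close>)
  have "?F \<subseteq> {..<m} \<times> {..<n}" by (auto simp: filled_cells_def)
  then have fin: "finite ?F" using finite_subset by blast
  have pm: "plus_minus_entries Z m n A = (\<Sum>c\<in>?F. {#?e c, inv\<^bsub>Z\<^esub> (?e c)#})"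
    unfolding plus_minus_entries_def by (intro sum.cong) auto
  interpret half_set Z J ?F ?e
    using J fin entry one none by (intro half_set_if_count_eq_1) (auto simp: pm)
  \<comment> \<open>The line of a cell is its first coordinate; \<open>Pair i\<close> turns the
    column indices of row \<open>i\<close> into cells.\<close>
  interpret R: ordered_lines Z J ?F ?e m h fst \<omega>r
  proof (rule ordered_linesI)
    show "bij_betw (Pair i) (filled_in_row n A i) {c \<in> ?F. fst c = i}" if "i < m" for i
      using that by (auto simp: bij_betw_def inj_on_def filled_in_row_def filled_cells_def)
    show "simple_ordering Z ((\<lambda>j. ?e (i, j)) ` filled_in_row n A i) (\<omega>r i)" if "i < m" for i
      using assms(7) that by (simp add: simple_array_def row_entries_def)
  qed (use row in \<open>auto simp: filled_cells_def\<close>)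
  interpret C: ordered_lines Z J ?F ?e n k snd \<omega>c
  proof (rule ordered_linesI)
    show "bij_betw (\<lambda>i. (i, j)) (filled_in_col m A j) {c \<in> ?F. snd c = j}" if "j < n" for j
      using that by (auto simp: bij_betw_def inj_on_def filled_in_col_def filled_cells_def)
    show "simple_ordering Z ((\<lambda>i. ?e (i, j)) ` filled_in_col m A j) (\<omega>c j)" if "j < n" for j
      using assms(7) that by (simp add: simple_array_def col_entries_def)
  qed (use col in \<open>auto simp: filled_cells_def\<close>)
  have K: "complete_multipartite (?v div t) t K"
    using complete_multipartite_rcosets[OF J finZ] cardJ carrier
    by (simp add: K_def order_def)
  have vertsK: "verts K = carrier Z"
    using rcosets_part_G[OF J] by (simp add: K_def multipartite_graph_def)
  \<comment> \<open>The cyclic group that \<open>cyclic_path_decomposition\<close> rebuilds from the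
    number of vertices is \<open>Z\<close> again.\<close>
  have Z: "integer_mod_group (card (verts K)) = Z" using vertsK carrier by (simp add: Z_def)
  have "cyclic_path_decomposition h K Dr"
    unfolding cyclic_path_decomposition_def Let_def Z
    using R.path_decomposition_lines R.translate_block vertsK by (simp add: K_def Dr_def)
  moreover have "cyclic_path_decomposition k K Dc"
    unfolding cyclic_path_decomposition_def Let_def Z
    using C.path_decomposition_lines C.translate_block vertsK by (simp add: K_def Dc_def)
  \<comment> \<open>A cell is the pair of its row and its column, which is the injectivity required
    of \<open>fst\<close> and \<open>snd\<close>.\<close>
  moreover have "orthogonal_decompositions Dr Dc"
    unfolding Dr_def Dc_def
    by (rule orthogonal_lines[OF R.ordered_lines_axioms C.ordered_lines_axioms])
      (auto simp: inj_on_def)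
  ultimately show ?thesis using K unfolding mh by blast
qed

end
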